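(* Consider the class $\mathcal{H}$ of predictors (with $d_N=k(n+1)$ trainable parameters and weight bound $W$), the supervision data $\{((x_{si},t_{si}),y_{si})\in\mathcal{D}\times[-M,M] : i=1,\dots,N_s\}$, and the empirical PINN loss $\hat R$ for the Hamilton--Jacobi--Bellman PDE with initial condition $g$, all as defined in the context. Let $g$ be bounded by $\|g\|_\infty\le G$, and let $$\sigma^2=\frac{1}{N_s}\sum_{i=1}^{N_s}\mathbb{E}[z_i^2],\qquad z_i=y_{si}-\mathbb{E}[y_{si}\mid (x_{si},t_{si})].$$ Then there exists a constant $a>0$ such that for all sufficiently small $\eta>0$ and for all $\delta\in(0,1)$ the following holds. If with probability at least $1-\delta$ (with respect to the sampling of the supervision data) there exists $h_w\in\mathcal{H}$ such that $$\hat R(h_w)\le \sigma^2-a\eta,$$ then the size of the model $d_N$ is lower bounded in terms of the number of supervision samples $N_s$: $$d_N\cdot\left(\ln(d_N)+\ln\left(\frac{4W^2}{\eta^2}\right)\right)\ \ge\ \frac{N_s\eta^2}{144M^4}-2\ln\left(\frac{4}{1-\delta}\right).$$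
   Context: Domain: for $B,T>0$, $\mathcal{D}=[-B,B]^n\times[0,T]$. The HJB PDE is $\partial_t u-\nabla^2u+\|\nabla u\|_2^2=0$ on $\mathcal{D}$ with $u(x,0)=g(x)$ for $x\in[-B,B]^n$, where $\nabla$ and $\nabla^2=\sum_{i=1}^n\partial_{x_i}^2$ are the spatial gradient and spatial Laplacian. Class $\mathcal{H}$: let $f:\mathbb{R}^k\to\mathbb{R}$ be a fixed non-linear function with $|f(z)|\le C_1$ and $\|\nabla f(z)\|\le C_2$ for all $z\in\mathbb{R}^k$; $|f(z_1)-f(z_2)|\le L_1\|z_1-z_2\|$ for all $z_1,z_2$; and either $\|\nabla f(z_1)-\nabla f(z_2)\|\le L_2\|z_1-z_2\|$ for all $z_1,z_2$, or $\|Hf(z)\|_F\le C_3$ for all $z$ ($Hf$ the Hessian, $\|\cdot\|_F$ the Frobenius norm). $\mathcal{H}$ is the set of functions $h_w:\mathbb{R}^n\times\mathbb{R}\to\mathbb{R}$, $h_w(x,t)=f(W_1x+w_2t)$, with $W_1\in\mathbb{R}^{k\times n}$, $w_2\in\mathbb{R}^k$ and parameters $w=(W_1,w_2)$ satisfying $\|w\|_2\le W$. The number of trainable parameters is $d_N=k(n+1)$. Loss: we are given collocation points $(x_{ri},t_{ti})\in\mathcal{D}$, $i=1,\dots,N_r$, and $x_{0j}\in[-B,B]^n$, $j=1,\dots,N_0$, parameters $\lambda_0,\lambda_s>0$, and randomly sampled supervision data $((x_{si},t_{si}),y_{si})\in\mathcal{D}\times[-M,M]$, $i=1,\dots,N_s$,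 where $M>0$. Then $$\hat R(h_w)=\frac1{N_r}\sum_{i=1}^{N_r}\Big(\partial_th_w(x_{ri},t_{ti})-\nabla^2h_w(x_{ri},t_{ti})+\|\nabla h_w(x_{ri},t_{ti})\|_2^2\Big)^2+\frac{\lambda_0}{N_0}\sum_{j=1}^{N_0}\big(h_w(x_{0j},0)-g(x_{0j})\big)^2+\frac{\lambda_s}{N_s}\sum_{l=1}^{N_s}\big(h_w(x_{sl},t_{sl})-y_{sl}\big)^2 .$$ The constant $a$ depends on the specifics of the loss function ($\lambda_s$ and the collocation points) and on the choice of $\mathcal{H}$.
   Formalization: The threshold for "sufficiently small η" is uniform in N_s and the data law only when λ_s ≥ 1; for λ_s < 1 it may depend on N_s and the data, since a uniform one fails there (f = sin z_1, g = 0, fair ±1 labels, zero weights). *)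

theory Defs
  imports "HOL-Probability.Probability"
begin

definition partial :: "'n \<Rightarrow> (real ^ 'n \<Rightarrow> real) \<Rightarrow> real ^ 'n \<Rightarrow> real"
  where "partial i u x = deriv (\<lambda>s. u (x + s *\<^sub>R axis i 1)) 0"

definition grad :: "(real ^ 'n \<Rightarrow> real) \<Rightarrow> real ^ 'n \<Rightarrow> real ^ 'n"
  where "grad u x = (\<chi> i. partial i u x)"

(* The norm of the type real ^ 'n ^ 'n is the Frobenius norm. *)
definition hessian :: "(real ^ 'n \<Rightarrow> real) \<Rightarrow> real ^ 'n \<Rightarrow> real ^ 'n ^ 'n"
  where "hessian u x = (\<chi> i j. partial j (partial i u) x)"

definition laplacian :: "(real ^ 'n \<Rightarrow> real) \<Rightarrow> real ^ 'n \<Rightarrow> real"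
  where "laplacian u x = (\<Sum>i\<in>UNIV. partial i (partial i u) x)"

definition space_box :: "real \<Rightarrow> (real ^ 'n) set"
  where "space_box B = {x. \<forall>i. x $ i \<in> {-B..B}}"

definition hjb_domain :: "real \<Rightarrow> real \<Rightarrow> ((real ^ 'n) \<times> real) set"
  where "hjb_domain B T = space_box B \<times> {0..T}"

definition hjb_residual :: "((real ^ 'n) \<times> real \<Rightarrow> real) \<Rightarrow> (real ^ 'n) \<times> real \<Rightarrow> real"
  where "hjb_residual u = (\<lambda>(x, t). deriv (\<lambda>s. u (x, s)) t
           - laplacian (\<lambda>x'. u (x', t)) x + (norm (grad (\<lambda>x'. u (x', t)) x))\<^sup>2)"

definition predictor ::
    "(real ^ 'k \<Rightarrow> real) \<Rightarrow> (real ^ 'n ^ 'k) \<times> (real ^ 'k) \<Rightarrow> (real ^ 'n) \<times> real \<Rightarrow> real"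
  where "predictor f w = (\<lambda>(x, t). f (fst w *v x + t *\<^sub>R snd w))"

(* The product norm on the pair (W1, w2) is the Euclidean norm of the vector
   of all k * (n + 1) weights. *)
definition predictor_class ::
    "(real ^ 'k \<Rightarrow> real) \<Rightarrow> real \<Rightarrow> ((real ^ 'n) \<times> real \<Rightarrow> real) set"
  where "predictor_class f W = {predictor f w | w. norm w \<le> W}"

definition pinn_risk ::
    "(real ^ 'n \<Rightarrow> real) \<Rightarrow> real \<Rightarrow> real \<Rightarrow> nat \<Rightarrow> (nat \<Rightarrow> (real ^ 'n) \<times> real) \<Rightarrow>
     nat \<Rightarrow> (nat \<Rightarrow> real ^ 'n) \<Rightarrow> nat \<Rightarrow> (nat \<Rightarrow> ((real ^ 'n) \<times> real) \<times> real) \<Rightarrow>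
     ((real ^ 'n) \<times> real \<Rightarrow> real) \<Rightarrow> real"
  where "pinn_risk g lam0 lams Nr xtr N0 x0 Ns data h =
           1 / real Nr * (\<Sum>i=1..Nr. (hjb_residual h (xtr i))\<^sup>2)
         + lam0 / real N0 * (\<Sum>j=1..N0. (h (x0 j, 0) - g (x0 j))\<^sup>2)
         + lams / real Ns * (\<Sum>l=1..Ns. (h (fst (data l)) - snd (data l))\<^sup>2)"

(* Independent samples; identical distribution is not required, which is why the noise
   level below averages over the samples. *)
definition supervision_sample ::
    "'a measure \<Rightarrow> real \<Rightarrow> real \<Rightarrow> real \<Rightarrow> nat \<Rightarrow>
     (nat \<Rightarrow> 'a \<Rightarrow> (real ^ 'n) \<times> real) \<Rightarrow> (nat \<Rightarrow> 'a \<Rightarrow> real) \<Rightarrow> bool"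
  where "supervision_sample P B T M Ns X Y \<longleftrightarrow>
           prob_space P \<and>
           prob_space.indep_vars P (\<lambda>_. borel) (\<lambda>i \<omega>. (X i \<omega>, Y i \<omega>)) {1..Ns} \<and>
           (\<forall>i\<in>{1..Ns}. \<forall>\<omega>\<in>space P. X i \<omega> \<in> hjb_domain B T \<and> Y i \<omega> \<in> {-M..M})"

definition label_noise ::
    "'a measure \<Rightarrow> ('a \<Rightarrow> (real ^ 'n) \<times> real) \<Rightarrow> ('a \<Rightarrow> real) \<Rightarrow> 'a \<Rightarrow> real"
  where "label_noise P X Y \<omega> = Y \<omega> - real_cond_exp P (vimage_algebra (space P) X borel) Y \<omega>"

definition noise_variance ::
    "'a measure \<Rightarrow> nat \<Rightarrow> (nat \<Rightarrow> 'a \<Rightarrow> (real ^ 'n) \<times> real) \<Rightarrow> (nat \<Rightarrow> 'a \<Rightarrow> real) \<Rightarrow> real"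
  where "noise_variance P Ns X Y =
           1 / real Ns * (\<Sum>i=1..Ns. integral\<^sup>L P (\<lambda>\<omega>. (label_noise P (X i) (Y i) \<omega>)\<^sup>2))"

(* "Q holds with probability at least p", meaningful also when the set of outcomes
   satisfying Q is not known to be measurable. *)
definition holds_with_prob_at_least :: "'a measure \<Rightarrow> real \<Rightarrow> ('a \<Rightarrow> bool) \<Rightarrow> bool"
  where "holds_with_prob_at_least P p Q \<longleftrightarrow>
           (\<exists>E\<in>sets P. p \<le> measure P E \<and> (\<forall>\<omega>\<in>E. Q \<omega>))"

end

theory Submission
  imports Defs
begin

text \<open>
  For a fixed predictor \<open>h\<close> the squared errors are independent and bounded, and their mean
  expectation is at least \<open>\<sigma>\<^sup>2\<close>, because the conditional expectation of the label minimises the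
  mean squared error. By Hoeffding's inequality, \<open>h\<close> therefore stays below \<open>\<sigma>\<^sup>2 - a\<eta>/2\<close> only with
  probability exponentially small in \<open>N\<^sub>s a\<^sup>2 \<eta>\<^sup>2\<close>. As \<open>h\<^sub>w\<close> is Lipschitz in \<open>w\<close>, uniformly on the
  domain, a union bound over a \<open>d\<^sub>N\<eta>\<close>-net of the weights, of cardinality at most
  \<open>(5W/\<eta>)^d\<^sub>N \<le> (4W\<^sup>2/\<eta>\<^sup>2)^d\<^sub>N\<close>, covers all predictors at once. The constant \<open>a\<close> is free, so it absorbs every constant that enters. Since the
  residual and boundary terms of the risk are nonnegative, this applies whenever \<open>\<lambda>\<^sub>s \<ge> 1\<close>; otherwise
  \<open>\<eta>\<close> may be taken small depending on \<open>N\<^sub>s\<close>, and the logarithm in the bound diverges.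
\<close>

section \<open>Grid nets of Euclidean balls\<close>

text \<open>Each coordinate is rounded down to a multiple of \<open>s\<close>, and the error is
  summed in the l1 norm, whence the factor \<open>DIM('a)\<close>. The net need not lie inside the
  ball of radius \<open>R\<close>.\<close>

lemma finite_net_cball:
  fixes R s :: real
  assumes "0 < s" "s \<le> R"
  obtains S :: "'a::euclidean_space set"
  where "finite S" "real (card S) \<le> (5 * R / s) ^ DIM('a)"
    "\<And>x. norm x \<le> R \<Longrightarrow> \<exists>y\<in>S. norm (x - y) \<le> DIM('a) * s"
proof
  define m where "m = \<lceil>R / s\<rceil>"
  define G where "G k = (\<Sum>b\<in>Basis. (s * of_int (k b)) *\<^sub>R b)" for k :: "'a \<Rightarrow> int"
  define D where "D = (Basis :: 'a set) \<rightarrow>\<^sub>E {-m..m}"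
  have Rs: "1 \<le> R / s" using assms by simp
  have m: "R / s \<le> m" "m \<le> R / s + 1" by (auto simp: m_def)
  have finD: "finite D" unfolding D_def by (intro finite_PiE) auto
  show "finite (G ` D)" using finD by simp
  have "real (card (G ` D)) \<le> real (card D)" using card_image_le[OF finD] by simp
  also have "card D = nat (2 * m + 1) ^ DIM('a)"
    unfolding D_def by (subst card_PiE) (auto simp: algebra_simps)
  also have "real \<dots> = real_of_int (2 * m + 1) ^ DIM('a)" using m Rs by simp
  \<comment> \<open>Per axis, \<open>2 * m + 1\<close> is at most \<open>2 * (R / s) + 3\<close>,
    and \<open>R / s\<close> is at least 1.\<close>
  also have "\<dots> \<le> (5 * R / s) ^ DIM('a)"
    using m Rs by (intro power_mono) (auto simp del: of_int_add)
  finally show "real (card (G ` D)) \<le> (5 * R / s) ^ DIM('a)" .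
  fix x :: 'a assume x: "norm x \<le> R"
  define k where "k = restrict (\<lambda>b. \<lfloor>x \<bullet> b / s\<rfloor>) Basis"
  have "k b \<in> {-m..m}" if b: "b \<in> Basis" for b
  proof -
    have "\<bar>x \<bullet> b\<bar> \<le> R" using Basis_le_norm[OF b, of x] x by simp
    then have "\<bar>x \<bullet> b / s\<bar> \<le> R / s" using assms by (simp add: divide_right_mono)
    then have "- real_of_int m \<le> x \<bullet> b / s" "x \<bullet> b / s \<le> real_of_int m" using m by linarith+
    then show ?thesis unfolding k_def using b by (auto simp: le_floor_iff floor_le_iff)
  qed
  then have kD: "k \<in> D" unfolding D_def by (auto simp: k_def)
  have "norm (x - G k) \<le> (\<Sum>b\<in>Basis. \<bar>(x - G k) \<bullet> b\<bar>)" by (rule norm_le_l1)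
  also have "\<dots> \<le> (\<Sum>b\<in>(Basis::'a set). s)"
  proof (rule sum_mono)
    fix b :: 'a assume b: "b \<in> Basis"
    have "(x - G k) \<bullet> b = s * (x \<bullet> b / s - \<lfloor>x \<bullet> b / s\<rfloor>)"
      using b assms unfolding G_def k_def by (simp add: inner_diff_left field_simps)
    moreover have "\<bar>x \<bullet> b / s - \<lfloor>x \<bullet> b / s\<rfloor>\<bar> \<le> 1" by linarith
    ultimately show "\<bar>(x - G k) \<bullet> b\<bar> \<le> s" using assms by (simp add: abs_mult)
  qed
  finally show "\<exists>y\<in>G ` D. norm (x - y) \<le> DIM('a) * s" using kD by auto
qed

section \<open>Lipschitz dependence of predictors on their weights\<close>

text \<open>Here \<open>norm A\<close> is the Frobenius norm; Cauchy-Schwarz applies row by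
  row.\<close>

lemma norm_matrix_vector_mult_le:
  fixes A :: "real ^ 'n ^ 'm"
  shows "norm (A *v x) \<le> norm A * norm x"
proof -
  have "norm (A *v x) = L2_set (\<lambda>i. \<bar>A $ i \<bullet> x\<bar>) UNIV"
    by (simp add: norm_vec_def matrix_mult_dot)
  also have "\<dots> \<le> L2_set (\<lambda>i. norm (A $ i) * norm x) UNIV"
    by (intro L2_set_mono Cauchy_Schwarz_ineq2) auto
  also have "\<dots> = norm A * norm x"
    by (simp add: norm_vec_def[of A] L2_set_left_distrib)
  finally show ?thesis .
qed

lemma norm_le_hjb_domain:
  fixes x :: "real ^ 'n" and B :: real
  assumes "(x, t) \<in> hjb_domain B T"
  shows "norm x \<le> CARD('n) * B" "\<bar>t\<bar> \<le> T"
proof -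
  have "norm x \<le> (\<Sum>i\<in>UNIV. \<bar>x $ i\<bar>)" by (rule norm_le_l1_cart)
  also have "\<dots> \<le> (\<Sum>i\<in>(UNIV::'n set). B)"
    using assms by (intro sum_mono) (auto simp: hjb_domain_def space_box_def abs_le_iff minus_le_iff)
  finally show "norm x \<le> CARD('n) * B" by simp
  show "\<bar>t\<bar> \<le> T" using assms by (auto simp: hjb_domain_def)
qed

text \<open>The argument of \<open>f\<close> is linear in the weights, and its coefficients
  \<open>x\<close> and \<open>t\<close> are bounded on the domain. This transfers a net of weights
  to a net of predictors.\<close>

lemma predictor_lipschitz:
  fixes f :: "real ^ 'k \<Rightarrow> real" and p :: "(real ^ 'n) \<times> real" and B :: real
  assumes f: "\<And>z1 z2. \<bar>f z1 - f z2\<bar> \<le> L * norm (z1 - z2)" and "0 \<le> L"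
    and p: "p \<in> hjb_domain B T"
  shows "\<bar>predictor f w p - predictor f w' p\<bar> \<le> L * (CARD('n) * B + T) * norm (w - w')"
proof -
  obtain x t where [simp]: "p = (x, t)" by (cases p)
  note xt = norm_le_hjb_domain[OF p[simplified]]
  have "norm ((fst w *v x + t *\<^sub>R snd w) - (fst w' *v x + t *\<^sub>R snd w'))
      = norm (fst (w - w') *v x + t *\<^sub>R snd (w - w'))"
    by (simp add: matrix_vector_mult_diff_rdistrib algebra_simps)
  also have "\<dots> \<le> norm (fst (w - w')) * norm x + \<bar>t\<bar> * norm (snd (w - w'))"
    by (rule order_trans[OF norm_triangle_ineq]) (simp add: norm_matrix_vector_mult_le)
  also have "\<dots> \<le> norm (w - w') * (CARD('n) * B) + T * norm (w - w')"
  proof (intro add_mono mult_mono xt)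
    show "norm (fst (w - w')) \<le> norm (w - w')" "norm (snd (w - w')) \<le> norm (w - w')"
      using norm_fst_le[of "fst (w - w')" "snd (w - w')"] norm_snd_le[of "snd (w - w')" "fst (w - w')"]
      by (simp_all only: prod.collapse)
  qed (use xt in \<open>auto intro: order_trans[OF abs_ge_zero]\<close>)
  finally have "norm ((fst w *v x + t *\<^sub>R snd w) - (fst w' *v x + t *\<^sub>R snd w'))
      \<le> (CARD('n) * B + T) * norm (w - w')" by (simp add: algebra_simps)
  from mult_left_mono[OF this \<open>0 \<le> L\<close>] order_trans[OF f] show ?thesis
    by (simp add: predictor_def mult.assoc)
qed

lemma borel_measurable_predictor:
  assumes "continuous_on UNIV f"
  shows "predictor f w \<in> borel_measurable borel"
  unfolding predictor_def case_prod_beta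
  by (intro borel_measurable_continuous_onI continuous_on_compose2[OF assms]
      continuous_intros bounded_linear.continuous_on[OF matrix_vector_mul_bounded_linear]) auto

section \<open>Conditional expectation and the noise level\<close>

text \<open>Pythagoras in L2: with \<open>v\<close> the conditional expectation,
  \<open>u - v\<close> is \<open>F\<close>-measurable and hence orthogonal to \<open>Z - v\<close>,
  so replacing \<open>v\<close> by \<open>u\<close> adds the integral of the square of
  \<open>u - v\<close>. The bounds on \<open>Z\<close> and \<open>u\<close> make all products
  integrable.\<close>

lemma (in finite_measure_subalgebra) real_cond_exp_minimizes_square_error:
  assumes [measurable]: "Z \<in> borel_measurable M" "u \<in> borel_measurable F"
    and Z: "\<And>x. x \<in> space M \<Longrightarrow> \<bar>Z x\<bar> \<le> b" and u: "\<And>x. x \<in> space M \<Longrightarrow> \<bar>u x\<bar> \<le> c"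
  shows "(\<integral>x. (Z x - real_cond_exp M F Z x)\<^sup>2 \<partial>M) \<le> (\<integral>x. (u x - Z x)\<^sup>2 \<partial>M)"
proof -
  define v where "v = real_cond_exp M F Z"
  have [measurable]: "u \<in> borel_measurable M" by (rule measurable_from_subalg[OF subalg]) simp
  have [measurable]: "v \<in> borel_measurable F" "v \<in> borel_measurable M"
    by (auto simp: v_def)
  have intZ: "integrable M Z"
    by (rule integrable_const_bound[of _ b]) (use Z in auto)
  have lo: "AE x in M. - b \<le> v x" unfolding v_def
    by (rule real_cond_exp_ge_c[OF intZ]) (use Z in \<open>force simp: abs_le_iff intro!: AE_I2\<close>)
  have hi: "AE x in M. v x \<le> b" unfolding v_def
    by (rule real_cond_exp_le_c[OF intZ]) (use Z in \<open>force simp: abs_le_iff intro!: AE_I2\<close>)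
  have v: "AE x in M. \<bar>v x\<bar> \<le> b" using lo hi by eventually_elim auto
  \<comment> \<open>The conditional expectation obeys the bound \<open>b\<close> only almost
    everywhere, so this criterion asks for a bound on \<open>p\<close> only at the points where it
    does.\<close>
  have bd: "integrable M p" if "p \<in> borel_measurable M"
    "\<And>x. x \<in> space M \<Longrightarrow> \<bar>v x\<bar> \<le> b \<Longrightarrow> \<bar>p x\<bar> \<le> q" for p :: "'a \<Rightarrow> real" and q
    using v AE_space by (intro integrable_const_bound[of _ q] that) (use that in \<open>auto elim: AE_mp\<close>)
  have sq: "\<bar>x\<^sup>2\<bar> \<le> y\<^sup>2" if "\<bar>x\<bar> \<le> y" for x y :: real
    using power_mono[OF that, of 2] by simp
  have i1: "integrable M (\<lambda>x. (Z x - v x)\<^sup>2)"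
    by (rule bd[of _ "(2 * b)\<^sup>2"], measurable, rule sq) (use Z in fastforce)
  have i2: "integrable M (\<lambda>x. (u x - v x)\<^sup>2)"
    by (rule bd[of _ "(c + b)\<^sup>2"], measurable, rule sq) (use u in fastforce)
  have i3: "integrable M (\<lambda>x. (u x - v x) * Z x)"
    by (rule bd[of _ "(c + b) * b"]) (auto simp: abs_mult intro!: mult_mono dest: Z u)
  \<comment> \<open>Orthogonality: against the \<open>F\<close>-measurable factor
    \<open>u - v\<close>, \<open>Z\<close> and \<open>v\<close> have the same integral.\<close>
  note orth = real_cond_exp_intg[OF i3, folded v_def]
  have "(\<integral>x. (Z x - v x)\<^sup>2 \<partial>M) \<le> (\<integral>x. (Z x - v x)\<^sup>2 \<partial>M) + (\<integral>x. (u x - v x)\<^sup>2 \<partial>M)"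
    by simp
  also have "\<dots> = (\<integral>x. (Z x - v x)\<^sup>2 + (u x - v x)\<^sup>2 + 2 * ((u x - v x) * v x)
      - 2 * ((u x - v x) * Z x) \<partial>M)"
    using i1 i2 i3 orth by simp
  also have "\<dots> = (\<integral>x. (u x - Z x)\<^sup>2 \<partial>M)"
    by (intro Bochner_Integration.integral_cong) (auto simp: power2_eq_square algebra_simps)
  finally show ?thesis by (simp add: v_def)
qed

text \<open>The composition of \<open>h\<close> with \<open>X\<close> is measurable for the
  sigma-algebra generated by \<open>X\<close>, hence a competitor of the conditional expectation.
  Summed over the samples, this bounds the noise level by the expected squared error of any fixed
  predictor.\<close>

lemma label_noise_square_le:
  assumes "prob_space P" and [measurable]: "X \<in> borel_measurable P" "Y \<in> borel_measurable P"
    and h: "h \<in> borel_measurable borel" "\<And>p. \<bar>h p\<bar> \<le> c"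
    and Y: "\<And>\<omega>. \<omega> \<in> space P \<Longrightarrow> \<bar>Y \<omega>\<bar> \<le> b"
  shows "(\<integral>\<omega>. (label_noise P X Y \<omega>)\<^sup>2 \<partial>P) \<le> (\<integral>\<omega>. (h (X \<omega>) - Y \<omega>)\<^sup>2 \<partial>P)"
proof -
  interpret prob_space P by fact
  define F where "F = vimage_algebra (space P) X borel"
  have "subalgebra P F"
    unfolding subalgebra_def F_def using sets_image_in_sets[OF refl assms(2)] by simp
  then interpret finite_measure_subalgebra P F by unfold_locales
  have "X \<in> measurable F borel" unfolding F_def by (rule measurable_vimage_algebra1) auto
  from measurable_compose[OF this h(1)] show ?thesis
    unfolding label_noise_def F_def[symmetric]
    by (intro real_cond_exp_minimizes_square_error[of Y _ b c] Y h(2)) auto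
qed

section \<open>Concentration for one predictor, then uniformly over the class\<close>

lemma supervision_sampleD:
  assumes "supervision_sample P B T M N X Y"
  shows "prob_space P"
    and "prob_space.indep_vars P (\<lambda>_. borel) (\<lambda>i \<omega>. (X i \<omega>, Y i \<omega>)) {1..N}"
    and "\<And>i. i \<in> {1..N} \<Longrightarrow> X i \<in> borel_measurable P"
    and "\<And>i. i \<in> {1..N} \<Longrightarrow> Y i \<in> borel_measurable P"
    and "\<And>i \<omega>. i \<in> {1..N} \<Longrightarrow> \<omega> \<in> space P \<Longrightarrow> X i \<omega> \<in> hjb_domain B T"
    and "\<And>i \<omega>. i \<in> {1..N} \<Longrightarrow> \<omega> \<in> space P \<Longrightarrow> \<bar>Y i \<omega>\<bar> \<le> M"
proof -
  show P: "prob_space P" using assms by (simp add: supervision_sample_def)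
  show ind: "prob_space.indep_vars P (\<lambda>_. borel) (\<lambda>i \<omega>. (X i \<omega>, Y i \<omega>)) {1..N}"
    using assms by (simp add: supervision_sample_def)
  interpret prob_space P by fact
  fix i assume i: "i \<in> {1..N}"
  then have *: "(\<lambda>\<omega>. (X i \<omega>, Y i \<omega>)) \<in> borel_measurable P" using ind unfolding indep_vars_def by blast
  show "X i \<in> borel_measurable P" "Y i \<in> borel_measurable P"
    using measurable_compose[OF *, of fst borel] measurable_compose[OF *, of snd borel]
    by (auto simp: borel_prod[symmetric])
  fix \<omega> assume "\<omega> \<in> space P"
  then show "X i \<omega> \<in> hjb_domain B T" "\<bar>Y i \<omega>\<bar> \<le> M"
    using assms i unfolding supervision_sample_def by (auto simp: abs_le_iff minus_le_iff)
qed

text \<open>Hoeffding's inequality for independent squared errors with values between 0 and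
  \<open>(c + M)\<^sup>2\<close>. The deviation is measured from the noise level instead of the mean
  \<open>\<mu>\<close>; as the noise level is the smaller of the two, the event only
  shrinks.\<close>

lemma square_error_lower_tail:
  fixes P :: "'a measure" and N :: nat and \<epsilon> :: real and X :: "nat \<Rightarrow> 'a \<Rightarrow> (real ^ 'n) \<times> real"
    and Y h
  defines "E \<equiv> {\<omega> \<in> space P. (\<Sum>i=1..N. (h (X i \<omega>) - Y i \<omega>)\<^sup>2) \<le> real N * (noise_variance P N X Y - \<epsilon>)}"
  assumes S: "supervision_sample P B T M N X Y" and "0 < N" "0 < M" "0 \<le> \<epsilon>"
    and h[measurable]: "h \<in> borel_measurable borel" and hc: "\<And>p. \<bar>h p\<bar> \<le> c"
  shows "E \<in> sets P"
    and "measure P E \<le> exp (- 2 * real N * \<epsilon>\<^sup>2 / (c + M) ^ 4)"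
proof -
  note S' = supervision_sampleD[OF S]
  interpret prob_space P by (rule S'(1))
  have [measurable]: "(\<lambda>\<omega>. h (X i \<omega>)) \<in> borel_measurable P" "Y i \<in> borel_measurable P"
    if "i \<in> {1..N}" for i
    using S'(3,4)[OF that] h by (auto intro: measurable_compose)
  show "E \<in> sets P" unfolding E_def by measurable
  let ?l = "\<lambda>i \<omega>. (h (X i \<omega>) - Y i \<omega>)\<^sup>2"
  have c: "0 \<le> c" using hc[of undefined] by linarith
  have le: "?l i \<omega> \<le> (c + M)\<^sup>2" if "i \<in> {1..N}" "\<omega> \<in> space P" for i \<omega>
  proof -
    have "\<bar>h (X i \<omega>) - Y i \<omega>\<bar> \<le> c + M" using S'(6)[OF that] hc[of "X i \<omega>"] by linarith
    from power_mono[OF this, of 2] show ?thesis by simp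
  qed
  define \<mu> where "\<mu> = (\<Sum>i=1..N. expectation (?l i))"
  interpret Hoeffding_ineq P "{1..N}" ?l "\<lambda>_. 0" "\<lambda>_. (c + M)\<^sup>2" \<mu>
  proof unfold_locales
    have [measurable]: "fst \<in> measurable borel (borel :: ((real ^ 'n) \<times> real) measure)"
      "snd \<in> measurable (borel :: (((real ^ 'n) \<times> real) \<times> real) measure) borel"
      by (auto intro!: borel_measurable_continuous_onI continuous_intros)
    have "(\<lambda>p. (h (fst p) - snd p)\<^sup>2) \<in> borel_measurable borel" by measurable
    then show "indep_vars (\<lambda>_. borel) ?l {1..N}"
      using indep_vars_compose2[OF S'(2), of "\<lambda>_ p. (h (fst p) - snd p)\<^sup>2" "\<lambda>_. borel"] by simp
  qed (auto intro!: AE_I2 le simp: \<mu>_def)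
  have "real N * noise_variance P N X Y = (\<Sum>i=1..N. \<integral>\<omega>. (label_noise P (X i) (Y i) \<omega>)\<^sup>2 \<partial>P)"
    using \<open>0 < N\<close> by (simp add: noise_variance_def)
  also have "\<dots> \<le> \<mu>" unfolding \<mu>_def
    by (intro sum_mono label_noise_square_le[where b = M and c = c] S' h hc)
  finally have "measure P E \<le> prob {\<omega>\<in>space P. (\<Sum>i=1..N. ?l i \<omega>) \<le> \<mu> - real N * \<epsilon>}"
    by (intro finite_measure_mono) (auto simp: E_def right_diff_distrib)
  also have "\<dots> \<le> exp (- 2 * (real N * \<epsilon>)\<^sup>2 / (\<Sum>i\<in>{1..N}. ((c + M)\<^sup>2 - 0)\<^sup>2))"
    using \<open>0 < N\<close> \<open>0 < M\<close> \<open>0 \<le> \<epsilon>\<close> c by (intro Hoeffding_ineq_le) auto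
  also have "- 2 * (real N * \<epsilon>)\<^sup>2 / (\<Sum>i\<in>{1..N}. ((c + M)\<^sup>2 - 0)\<^sup>2) = - 2 * real N * \<epsilon>\<^sup>2 / (c + M) ^ 4"
    using \<open>0 < N\<close> by (simp add: power_mult_distrib power2_eq_square power4_eq_xxxx mult_ac)
  finally show "measure P E \<le> exp (- 2 * real N * \<epsilon>\<^sup>2 / (c + M) ^ 4)" .
qed

text \<open>Half of the gap \<open>2 * \<epsilon>\<close> pays for moving from a good predictor to a
  nearby net point; the other half is the deviation in the tail bound, summed over the net. Only
  \<open>E\<close> and the finitely many events \<open>A v\<close> have to be measurable.\<close>

lemma prob_small_square_error_le:
  fixes f :: "real ^ 'k \<Rightarrow> real" and X :: "nat \<Rightarrow> 'a \<Rightarrow> (real ^ 'n) \<times> real"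
    and B C L s \<epsilon> :: real and N :: nat
  defines "d \<equiv> CARD('k) * (CARD('n) + 1)"
  assumes S: "supervision_sample P B T M N X Y" and "0 < N" "0 < M" "0 < B" "0 < T" "0 < s" "s \<le> W"
    and fb: "\<And>z. \<bar>f z\<bar> \<le> C" and fl: "\<And>z1 z2. \<bar>f z1 - f z2\<bar> \<le> L * norm (z1 - z2)"
    and "0 \<le> L" and fc: "continuous_on UNIV f"
    and \<epsilon>: "2 * (C + M) * (L * (CARD('n) * B + T) * (d * s)) \<le> \<epsilon>"
    and E: "\<And>\<omega>. \<omega> \<in> E \<Longrightarrow> \<exists>h\<in>predictor_class f W.
        (\<Sum>i=1..N. (h (X i \<omega>) - Y i \<omega>)\<^sup>2) \<le> real N * (noise_variance P N X Y - 2 * \<epsilon>)"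
    and "E \<in> sets P"
  shows "measure P E \<le> (5 * W / s) ^ d * exp (- 2 * real N * \<epsilon>\<^sup>2 / (C + M) ^ 4)"
proof -
  note S' = supervision_sampleD[OF S]
  interpret prob_space P by (rule S'(1))
  have C: "0 \<le> C" using fb[of undefined] by linarith
  have d: "DIM((real ^ 'n ^ 'k) \<times> (real ^ 'k)) = d" by (simp add: d_def algebra_simps)
  obtain Q :: "((real ^ 'n ^ 'k) \<times> (real ^ 'k)) set" where fin: "finite Q"
    and card: "real (card Q) \<le> (5 * W / s) ^ d"
    and net: "\<And>w. norm w \<le> W \<Longrightarrow> \<exists>v\<in>Q. norm (w - v) \<le> d * s"
    using finite_net_cball[OF \<open>0 < s\<close> \<open>s \<le> W\<close>, where 'a = "(real ^ 'n ^ 'k) \<times> (real ^ 'k)"]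
    unfolding d by blast
  define r where "r = L * (CARD('n) * B + T) * (d * s)"
  have r: "0 \<le> r" "2 * (C + M) * r \<le> \<epsilon>"
    using \<open>0 \<le> L\<close> \<open>0 < B\<close> \<open>0 < T\<close> \<open>0 < s\<close> \<epsilon> by (auto simp: r_def)
  have "0 \<le> 2 * (C + M) * r" using r C \<open>0 < M\<close> by simp
  with r have "0 \<le> \<epsilon>" by linarith
  define A where "A v = {\<omega> \<in> space P.
      (\<Sum>i=1..N. (predictor f v (X i \<omega>) - Y i \<omega>)\<^sup>2) \<le> real N * (noise_variance P N X Y - \<epsilon>)}" for v
  \<comment> \<open>Needed for all weights, since net points may have norm above
    \<open>W\<close>.\<close>
  have pb: "\<bar>predictor f v p\<bar> \<le> C" for v :: "(real ^ 'n ^ 'k) \<times> (real ^ 'k)" and p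
    using fb by (auto simp: predictor_def split: prod.split)
  note tail = square_error_lower_tail[OF S \<open>0 < N\<close> \<open>0 < M\<close> \<open>0 \<le> \<epsilon>\<close>
      borel_measurable_predictor[OF fc] pb, folded A_def]
  have "E \<subseteq> (\<Union>v\<in>Q. A v)"
  proof
    fix \<omega> assume \<omega>: "\<omega> \<in> E"
    then have sp: "\<omega> \<in> space P" using \<open>E \<in> sets P\<close> sets.sets_into_space by blast
    from E[OF \<omega>] obtain w where w: "norm w \<le> W"
      "(\<Sum>i=1..N. (predictor f w (X i \<omega>) - Y i \<omega>)\<^sup>2) \<le> real N * (noise_variance P N X Y - 2 * \<epsilon>)"
      unfolding predictor_class_def by blast
    obtain v where v: "v \<in> Q" "norm (w - v) \<le> d * s" using net[OF w(1)] by blast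
    \<comment> \<open>The difference of the squares factors as
      \<open>(?p + ?q - 2 * ?y) * (?p - ?q)\<close>.\<close>
    have "(predictor f v (X i \<omega>) - Y i \<omega>)\<^sup>2 \<le> (predictor f w (X i \<omega>) - Y i \<omega>)\<^sup>2 + \<epsilon>"
      if i: "i \<in> {1..N}" for i
    proof -
      let ?p = "predictor f v (X i \<omega>)" and ?q = "predictor f w (X i \<omega>)" and ?y = "Y i \<omega>"
      have "\<bar>?q - ?p\<bar> \<le> L * (CARD('n) * B + T) * norm (w - v)"
        by (rule predictor_lipschitz[OF fl \<open>0 \<le> L\<close> S'(5)[OF i sp]])
      also have "\<dots> \<le> r" unfolding r_def
        using v(2) \<open>0 \<le> L\<close> \<open>0 < B\<close> \<open>0 < T\<close> by (intro mult_left_mono) auto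
      finally have "\<bar>?p - ?q\<bar> \<le> r" by (simp add: abs_minus_commute)
      moreover have "\<bar>?p + ?q - 2 * ?y\<bar> \<le> 2 * (C + M)"
        using pb[of v "X i \<omega>"] pb[of w "X i \<omega>"] S'(6)[OF i sp]
        unfolding abs_le_iff by auto
      ultimately have "\<bar>(?p + ?q - 2 * ?y) * (?p - ?q)\<bar> \<le> 2 * (C + M) * r"
        unfolding abs_mult by (intro mult_mono) auto
      then have "(?p + ?q - 2 * ?y) * (?p - ?q) \<le> \<epsilon>" using r by linarith
      then show ?thesis by (simp add: power2_eq_square algebra_simps)
    qed
    then have "(\<Sum>i=1..N. (predictor f v (X i \<omega>) - Y i \<omega>)\<^sup>2)
        \<le> (\<Sum>i=1..N. (predictor f w (X i \<omega>) - Y i \<omega>)\<^sup>2 + \<epsilon>)" by (rule sum_mono)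
    also have "\<dots> \<le> real N * (noise_variance P N X Y - \<epsilon>)"
      using w(2) by (simp add: sum.distrib algebra_simps)
    finally show "\<omega> \<in> (\<Union>v\<in>Q. A v)" using v(1) sp by (auto simp: A_def)
  qed
  then have "measure P E \<le> measure P (\<Union>v\<in>Q. A v)"
    using tail(1) fin by (intro finite_measure_mono) auto
  also have "\<dots> \<le> (\<Sum>v\<in>Q. measure P (A v))"
    using tail(1) fin by (intro finite_measure_subadditive_finite) auto
  also have "\<dots> \<le> (\<Sum>v\<in>Q. exp (- 2 * real N * \<epsilon>\<^sup>2 / (C + M) ^ 4))"
    by (intro sum_mono tail(2))
  also have "\<dots> = card Q * exp (- 2 * real N * \<epsilon>\<^sup>2 / (C + M) ^ 4)" by simp
  also have "\<dots> \<le> (5 * W / s) ^ d * exp (- 2 * real N * \<epsilon>\<^sup>2 / (C + M) ^ 4)"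
    by (intro mult_right_mono card) auto
  finally show ?thesis .
qed

section \<open>From the risk to the lower bound on the number of parameters\<close>

lemma square_error_le_pinn_risk:
  assumes "1 \<le> lams" "0 \<le> lam0" "0 < N"
  shows "(\<Sum>i=1..N. (h (X i) - Y i)\<^sup>2) \<le> real N * pinn_risk g lam0 lams Nr xtr N0 x0 N (\<lambda>l. (X l, Y l)) h"
proof -
  let ?s = "\<Sum>i=1..N. (h (X i) - Y i)\<^sup>2"
  have "0 \<le> 1 / real Nr * (\<Sum>i=1..Nr. (hjb_residual h (xtr i))\<^sup>2)"
       "0 \<le> lam0 / real N0 * (\<Sum>j=1..N0. (h (x0 j, 0) - g (x0 j))\<^sup>2)"
    using assms by (auto intro!: mult_nonneg_nonneg sum_nonneg divide_nonneg_nonneg)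
  moreover have "1 / real N * ?s \<le> lams / real N * ?s"
    using assms by (intro mult_right_mono sum_nonneg) (auto simp: divide_right_mono)
  ultimately have "?s / N \<le> pinn_risk g lam0 lams Nr xtr N0 x0 N (\<lambda>l. (X l, Y l)) h"
    unfolding pinn_risk_def by simp
  then show ?thesis using assms by (simp add: field_simps)
qed

text \<open>The constants \<open>a\<close> and \<open>\<eta>0\<close> are chosen before the sample.
  The threshold \<open>\<eta>1\<close> comes after it, because for \<open>lams\<close> below 1 the
  risk need not dominate the mean squared error; for \<open>lams\<close> at least 1 the bound
  \<open>\<eta>0 \<le> \<eta>1\<close> keeps the smallness of \<open>\<eta>\<close> uniform in the
  sample.\<close>

theorem theorem4p1:
  fixes f :: "real ^ 'k \<Rightarrow> real"
    and g :: "real ^ 'n \<Rightarrow> real"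
    and B T W M G C1 C2 C3 L1 L2 lam0 lams :: real
    and Nr N0 :: nat
    and xtr :: "nat \<Rightarrow> (real ^ 'n) \<times> real"
    and x0 :: "nat \<Rightarrow> real ^ 'n"
  assumes "0 < B" and "0 < T" and "0 < W" and "0 < M" and "0 < lam0" and "0 < lams"
    and "0 < Nr" and "0 < N0"
    and "\<not> linear f"
    and "\<forall>z. f differentiable (at z)"
    and "\<forall>z. \<bar>f z\<bar> \<le> C1"
    and "\<forall>z. norm (grad f z) \<le> C2"
    and "\<forall>z1 z2. \<bar>f z1 - f z2\<bar> \<le> L1 * norm (z1 - z2)"
    and "(\<forall>z1 z2. norm (grad f z1 - grad f z2) \<le> L2 * norm (z1 - z2)) \<or>
         (\<forall>z. grad f differentiable (at z) \<and> norm (hessian f z) \<le> C3)"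
    and "\<forall>x\<in>space_box B. \<bar>g x\<bar> \<le> G"
    and "\<forall>i\<in>{1..Nr}. xtr i \<in> hjb_domain B T"
    and "\<forall>j\<in>{1..N0}. x0 j \<in> space_box B"
  shows "\<exists>a>0. \<exists>\<eta>0>0.
    \<forall>(P :: 'a measure) Ns (X :: nat \<Rightarrow> 'a \<Rightarrow> (real ^ 'n) \<times> real) (Y :: nat \<Rightarrow> 'a \<Rightarrow> real).
      0 < Ns \<and> supervision_sample P B T M Ns X Y \<longrightarrow>
      (\<exists>\<eta>1>0. (1 \<le> lams \<longrightarrow> \<eta>0 \<le> \<eta>1) \<and>
        (\<forall>\<eta> \<delta>. 0 < \<eta> \<and> \<eta> < \<eta>1 \<and> 0 < \<delta> \<and> \<delta> < 1 \<longrightarrow>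
          holds_with_prob_at_least P (1 - \<delta>)
            (\<lambda>\<omega>. \<exists>h\<in>predictor_class f W.
               pinn_risk g lam0 lams Nr xtr N0 x0 Ns (\<lambda>l. (X l \<omega>, Y l \<omega>)) h
                 \<le> noise_variance P Ns X Y - a * \<eta>) \<longrightarrow>
          (let dN = real (CARD('k) * (CARD('n) + 1)) in
             dN * (ln dN + ln (4 * W\<^sup>2 / \<eta>\<^sup>2))
               \<ge> real Ns * \<eta>\<^sup>2 / (144 * M ^ 4) - 2 * ln (4 / (1 - \<delta>)))))"
proof -
  define d where "d = CARD('k) * (CARD('n) + 1)"
  define C where "C = C1"
  define L where "L = \<bar>L1\<bar>"
  \<comment> \<open>The first summand pays for the distance \<open>d * \<eta>\<close> to the net.
    The second makes the Hoeffding exponent reach the rate with \<open>144 * M ^ 4\<close>, and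
    keeps \<open>a\<close> positive even if \<open>L\<close> is 0.\<close>
  define a where "a = 4 * (C + M) * (L * (CARD('n) * B + T) * d) + (C + M)\<^sup>2 / (6 * M\<^sup>2)"
  have fb: "\<bar>f z\<bar> \<le> C" for z using assms by (simp add: C_def)
  have C: "0 \<le> C" using fb[of undefined] by linarith
  have fl: "\<bar>f z1 - f z2\<bar> \<le> L * norm (z1 - z2)" for z1 z2
  proof -
    have "\<bar>f z1 - f z2\<bar> \<le> L1 * norm (z1 - z2)" using assms by blast
    also have "\<dots> \<le> L * norm (z1 - z2)" unfolding L_def by (intro mult_right_mono) auto
    finally show ?thesis .
  qed
  have fc: "continuous_on UNIV f"
    using \<open>\<forall>z. f differentiable (at z)\<close> by (simp add: continuous_at_imp_continuous_on differentiable_imp_continuous_within)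
  have L: "0 \<le> L" by (simp add: L_def)
  have aL: "0 \<le> 4 * (C + M) * (L * (CARD('n) * B + T) * d)"
    using C L \<open>0 < M\<close> \<open>0 < B\<close> \<open>0 < T\<close> by simp
  have aM: "0 < (C + M)\<^sup>2 / (6 * M\<^sup>2)" using C \<open>0 < M\<close> by simp
  have "0 < a" using aL aM by (simp add: a_def)
  have "0 < d" by (simp add: d_def)
  then have d: "1 \<le> real d" by simp
  \<comment> \<open>The value \<open>4 * W / 5\<close> is where \<open>5 * W / \<eta>\<close>, the
    base of the net cardinality, equals \<open>4 * W\<^sup>2 / \<eta>\<^sup>2\<close>; below it the
    latter is larger.\<close>
  have *: "\<exists>\<eta>1>0. (1 \<le> lams \<longrightarrow> 4 * W / 5 \<le> \<eta>1) \<and>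
      (\<forall>\<eta> \<delta>. 0 < \<eta> \<and> \<eta> < \<eta>1 \<and> 0 < \<delta> \<and> \<delta> < 1 \<longrightarrow>
        holds_with_prob_at_least P (1 - \<delta>)
          (\<lambda>\<omega>. \<exists>h\<in>predictor_class f W.
             pinn_risk g lam0 lams Nr xtr N0 x0 N (\<lambda>l. (X l \<omega>, Y l \<omega>)) h
               \<le> noise_variance P N X Y - a * \<eta>) \<longrightarrow>
        real N * \<eta>\<^sup>2 / (144 * M ^ 4) - 2 * ln (4 / (1 - \<delta>)) \<le> real d * (ln d + ln (4 * W\<^sup>2 / \<eta>\<^sup>2)))"
    (is "\<exists>\<eta>1>0. ?small \<eta>1 \<and> (\<forall>\<eta> \<delta>. ?rng \<eta>1 \<eta> \<delta> \<longrightarrow> ?hyp \<eta> \<delta> \<longrightarrow> ?concl \<eta> \<delta>)")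
    if N: "0 < N" and S: "supervision_sample P B T M N X Y"
    for P :: "'a measure" and N and X :: "nat \<Rightarrow> 'a \<Rightarrow> (real ^ 'n) \<times> real" and Y
  proof (cases "1 \<le> lams")
    case True
    have "?concl \<eta> \<delta>" if rng: "?rng (4 * W / 5) \<eta> \<delta>" and hyp: "?hyp \<eta> \<delta>" for \<eta> \<delta>
    proof -
      have \<eta>: "0 < \<eta>" "\<eta> \<le> W" "5 * \<eta> \<le> 4 * W" and \<delta>: "0 < \<delta>" "\<delta> < 1" using rng \<open>0 < W\<close> by auto
      obtain E where E: "E \<in> sets P" "1 - \<delta> \<le> measure P E"
        "\<And>\<omega>. \<omega> \<in> E \<Longrightarrow> \<exists>h\<in>predictor_class f W.
             pinn_risk g lam0 lams Nr xtr N0 x0 N (\<lambda>l. (X l \<omega>, Y l \<omega>)) h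
               \<le> noise_variance P N X Y - a * \<eta>"
        using hyp unfolding holds_with_prob_at_least_def by blast
      \<comment> \<open>The uniform bound is applied with grid width \<open>\<eta>\<close> and
        \<open>\<epsilon>\<close> equal to \<open>a * \<eta> / 2\<close>.\<close>
      have "4 * (C + M) * (L * (CARD('n) * B + T) * d) * (\<eta> / 2) \<le> a * (\<eta> / 2)"
        unfolding a_def using \<eta> aM by (intro mult_right_mono) auto
      then have \<epsilon>: "2 * (C + M) * (L * (CARD('n) * B + T) * (d * \<eta>)) \<le> a * \<eta> / 2"
        by (simp add: algebra_simps)
      have "measure P E \<le> (5 * W / \<eta>) ^ d * exp (- 2 * real N * (a * \<eta> / 2)\<^sup>2 / (C + M) ^ 4)"
        unfolding d_def
      proof (rule prob_small_square_error_le[OF S N \<open>0 < M\<close> \<open>0 < B\<close> \<open>0 < T\<close> \<eta>(1,2) fb fl L fc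
            \<epsilon>[unfolded d_def] _ E(1)])
        fix \<omega> assume "\<omega> \<in> E"
        from E(3)[OF this] obtain h where h: "h \<in> predictor_class f W"
          "pinn_risk g lam0 lams Nr xtr N0 x0 N (\<lambda>l. (X l \<omega>, Y l \<omega>)) h
            \<le> noise_variance P N X Y - 2 * (a * \<eta> / 2)" by auto
        have "(\<Sum>i=1..N. (h (X i \<omega>) - Y i \<omega>)\<^sup>2) \<le> real N * (noise_variance P N X Y - 2 * (a * \<eta> / 2))"
          using square_error_le_pinn_risk[OF True less_imp_le[OF \<open>0 < lam0\<close>] N] mult_left_mono[OF h(2)]
          by (rule order_trans) auto
        with h(1) show "\<exists>h\<in>predictor_class f W. (\<Sum>i=1..N. (h (X i \<omega>) - Y i \<omega>)\<^sup>2)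
            \<le> real N * (noise_variance P N X Y - 2 * (a * \<eta> / 2))" by blast
      qed
      also have "\<dots> \<le> (4 * W\<^sup>2 / \<eta>\<^sup>2) ^ d * exp (- (real N * \<eta>\<^sup>2 / (144 * M ^ 4)))"
      proof (intro mult_mono power_mono)
        have "5 * W * \<eta> * \<eta> \<le> 4 * W * W * \<eta>"
          using mult_right_mono[OF \<eta>(3), of "W * \<eta>"] \<eta> \<open>0 < W\<close> by (simp add: algebra_simps)
        then show "5 * W / \<eta> \<le> 4 * W\<^sup>2 / \<eta>\<^sup>2"
          using \<eta> by (simp add: field_simps power2_eq_square)
        have "((C + M)\<^sup>2 / (6 * M\<^sup>2))\<^sup>2 \<le> a\<^sup>2"
          unfolding a_def using aL aM by (intro power_mono) auto
        then have "(C + M) ^ 4 \<le> 36 * M ^ 4 * a\<^sup>2"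
          using \<open>0 < M\<close> by (simp add: power_divide power_mult_distrib field_simps flip: power_mult)
        \<comment> \<open>The choice of \<open>a\<close> gives 36. The target 144 requires only 72,
          because twice the square of \<open>a * \<eta> / 2\<close> is half of
          \<open>a\<^sup>2 * \<eta>\<^sup>2\<close>.\<close>
        also have "\<dots> \<le> 72 * M ^ 4 * a\<^sup>2" by (intro mult_right_mono) auto
        finally have "real N * \<eta>\<^sup>2 * (C + M) ^ 4 \<le> real N * \<eta>\<^sup>2 * (72 * M ^ 4 * a\<^sup>2)"
          by (intro mult_left_mono) auto
        moreover have "0 < (C + M) ^ 4" using C \<open>0 < M\<close> by simp
        ultimately have "real N * \<eta>\<^sup>2 / (144 * M ^ 4) \<le> 2 * real N * (a * \<eta> / 2)\<^sup>2 / (C + M) ^ 4"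
          using \<open>0 < M\<close> by (simp add: power_divide power_mult_distrib divide_le_eq le_divide_eq mult_ac)
        then show "exp (- 2 * real N * (a * \<eta> / 2)\<^sup>2 / (C + M) ^ 4) \<le> exp (- (real N * \<eta>\<^sup>2 / (144 * M ^ 4)))"
          by simp
      qed (use \<eta> \<open>0 < W\<close> in auto)
      finally have "1 - \<delta> \<le> (4 * W\<^sup>2 / \<eta>\<^sup>2) ^ d * exp (- (real N * \<eta>\<^sup>2 / (144 * M ^ 4)))"
        using E(2) by linarith
      then have "ln (1 - \<delta>) \<le> ln ((4 * W\<^sup>2 / \<eta>\<^sup>2) ^ d * exp (- (real N * \<eta>\<^sup>2 / (144 * M ^ 4))))"
        using \<delta> \<eta> \<open>0 < W\<close> by (subst ln_le_cancel_iff) (auto intro!: mult_pos_pos zero_less_power)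
      also have "\<dots> = d * ln (4 * W\<^sup>2 / \<eta>\<^sup>2) - real N * \<eta>\<^sup>2 / (144 * M ^ 4)"
        using \<eta> \<open>0 < W\<close> by (simp add: ln_mult_pos ln_realpow)
      finally have "real N * \<eta>\<^sup>2 / (144 * M ^ 4) \<le> d * ln (4 * W\<^sup>2 / \<eta>\<^sup>2) - ln (1 - \<delta>)" by simp
      \<comment> \<open>The target is weaker by nonnegative terms:
        \<open>- ln (1 - \<delta>)\<close> is at most \<open>2 * ln (4 / (1 - \<delta>))\<close>,
        and \<open>d * ln d\<close> is nonnegative.\<close>
      moreover have "ln (4 / (1 - \<delta>)) = ln 4 - ln (1 - \<delta>)" "ln (1 - \<delta>) \<le> 0" "0 < ln (4::real)"
        using \<delta> by (auto simp: ln_div)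
      moreover have "0 \<le> d * ln d" using d by simp
      ultimately show ?thesis unfolding distrib_left by linarith
    qed
    then show ?thesis using \<open>0 < W\<close> by (intro exI[of _ "4 * W / 5"]) auto
  next
    case False
    define c where "c = real N / (144 * M ^ 4)"
    have c: "0 \<le> c" by (simp add: c_def)
    \<comment> \<open>The bound \<open>2 * W * exp (- c / 2)\<close> solves
      \<open>ln (4 * W\<^sup>2 / \<eta>\<^sup>2) = c\<close> for \<open>\<eta>\<close>, and
      \<open>\<eta> \<le> 1\<close> gives \<open>c * \<eta>\<^sup>2 \<le> c\<close>, so the
      logarithm outweighs the sample term.\<close>
    have "?concl \<eta> \<delta>" if rng: "?rng (min 1 (2 * W * exp (- c / 2))) \<eta> \<delta>" for \<eta> \<delta>
    proof -
      have \<eta>: "0 < \<eta>" "\<eta> \<le> 1" "\<eta> \<le> 2 * W * exp (- c / 2)" and \<delta>: "0 < \<delta>" "\<delta> < 1" using rng by auto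
      have "ln \<eta> \<le> ln (2 * W * exp (- c / 2))" using \<eta> \<open>0 < W\<close> by (subst ln_le_cancel_iff) auto
      also have "\<dots> = ln (2 * W) - c / 2" using \<open>0 < W\<close> by (simp add: ln_mult_pos)
      finally have "c \<le> 2 * (ln (2 * W) - ln \<eta>)" by simp
      also have "\<dots> = ln ((2 * W / \<eta>)\<^sup>2)" using \<eta> \<open>0 < W\<close> by (simp add: ln_realpow ln_div)
      finally have *: "c \<le> ln (4 * W\<^sup>2 / \<eta>\<^sup>2)" by (simp add: power_divide power_mult_distrib)
      have "real N * \<eta>\<^sup>2 / (144 * M ^ 4) = c * \<eta>\<^sup>2" by (simp add: c_def)
      also have "\<dots> \<le> c * 1" using c \<eta> by (intro mult_left_mono power_le_one) auto
      also have "\<dots> \<le> ln d + ln (4 * W\<^sup>2 / \<eta>\<^sup>2)" using * ln_ge_zero[OF d] by simp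
      also have "\<dots> \<le> d * (ln d + ln (4 * W\<^sup>2 / \<eta>\<^sup>2))"
        using mult_right_mono[OF d, of "ln d + ln (4 * W\<^sup>2 / \<eta>\<^sup>2)"] * c ln_ge_zero[OF d] by simp
      finally have "real N * \<eta>\<^sup>2 / (144 * M ^ 4) \<le> d * (ln d + ln (4 * W\<^sup>2 / \<eta>\<^sup>2))" .
      moreover have "0 \<le> ln (4 / (1 - \<delta>))" using \<delta> by (intro ln_ge_zero) auto
      ultimately show ?thesis by linarith
    qed
    then show ?thesis using False \<open>0 < W\<close>
      by (intro exI[of _ "min 1 (2 * W * exp (- c / 2))"]) auto
  qed
  have "0 < 4 * W / 5" using \<open>0 < W\<close> by simp
  with \<open>0 < a\<close> * show ?thesis
    unfolding Let_def d_def[symmetric]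
    by - (rule exI[of _ a], rule conjI, assumption, rule exI[of _ "4 * W / 5"], blast)
qed

end
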